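(* Assume the setting and Assumptions A1, A2, A3 described in the context. Let $n\ge 1$ and let $(\ell,k)$ be any pair of positive integers with $\ell\ge 2$ such that $n=\ell k+r$ with $r\in\{0,1,\dots,k-1\}$. Then for every $\nu>0$, \[ \mathbb P\left(\Big\|\frac1n\sum_{i=1}^n X_i\Big\|\ \ge\ 4A_1C_1\Phi_{\mathcal C}(k)+4\sqrt{\frac{B\big(\sigma^2+C_2\Phi_{\mathcal C}(k)\big)\nu}{\ell}}+\frac{4c\nu}{3\ell}\right)\le 2e^{-\nu}, \] where $B=A_1^2+A_2$.
   Context: Let $(\mathcal B,\|\cdot\|)$ be a separable real Banach space with dual $\mathcal B^\star$ (dual norm $\|\cdot\|_\star$, duality pairing $\langle\cdot,\cdot\rangle$). For $r>0$ let $B(r)$ and $B^\star(r)$ denote the closed balls of radius $r$ centered at $0$ in $\mathcal B$ and $\mathcal B^\star$. Fix $c>0$ and put $\mathcal X=B(c)$. Let $(X_i)_{i\ge1}$ be a stochastic process on a probability space $(\Omega,\mathcal F,\mathbb P)$ with values in $\mathcal X$ which is centered ($\mathbb E X_i=0$ for all $i$, Bochner expectation). Let $\mathcal M_i=\sigma(X_1,\dots,X_i)$. $\mathcal C$-mixing: let $\mathcal C$ be a closed subspace of the Banach space of bounded real-valued functions on $\mathcal X$ (with the supremum norm), let $C(\cdot)$ be a seminorm on $\mathcal C$, and $\mathcal C_1=\{f\in\mathcal C: C(f)\le 1\}$. For integers $k\ge1$ the $\mathcal C$-mixing coefficients are $\Phi_{\mathcal C}(k)=\sup\{\|\mathbb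 E[\varphi(X_{i+k})\mid\mathcal M_i]-\mathbb E[\varphi(X_{i+k})]\|_{L_\infty(\mathbb P)}:\ \varphi\in\mathcal C_1,\ i\ge1\}$. Gâteaux derivatives: for $f:\mathcal B\to\mathbb R$, $x\in\mathcal B$, $v\in\mathcal B$, $\delta_v f(x)=\frac{d}{dt}\big|_{t=0}f(x+tv)$ when it exists; $\delta_{v,v}f(x)=\frac{d^2}{dt^2}\big|_{t=0}f(x+tv)$ denotes the second Gâteaux differential in direction $v$. Assumption A1: the norm $x\mapsto\|x\|$ is twice Gâteaux differentiable at every nonzero $x$ in all directions, and there are constants $A_1\ge1$, $A_2>0$ with $|\delta_v(\|x\|)|\le A_1\|v\|$ and $|\delta_{v,v}(\|x\|)|\le A_2\|v\|^2/\|x\|$ for all $x,v\in\mathcal B$, $x\ne0$. Assumption A2: there are constants $c,\sigma^2>0$ with $\|X_i\|\le c$ a.s. and $\mathbb E\|X_i\|^2\le\sigma^2$ for all $i$. Assumption A3: for each $s\in\mathcal B^\star$ the function $h_{1,s}(x)=\langle s,x\rangle$ (restricted to $\mathcal X$) belongs to $\mathcal C$, the function $h_2(x)=\|x\|^2$ belongs to $\mathcal C$, and $\sup_{s\in B^\star(1)}C(h_{1,s})\le C_1$, $C(h_2)\le C_2$ for constants $C_1,C_2\ge0$ (with $C_1>0$). *)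

theory Defs
  imports "HOL-Probability.Probability"
begin

definition gateaux_differentiable :: "('a::real_normed_vector \<Rightarrow> real) \<Rightarrow> 'a \<Rightarrow> 'a \<Rightarrow> bool" where
  "gateaux_differentiable f x v \<longleftrightarrow> (\<lambda>t::real. f (x + t *\<^sub>R v)) differentiable (at 0)"

definition gateaux_deriv :: "('a::real_normed_vector \<Rightarrow> real) \<Rightarrow> 'a \<Rightarrow> 'a \<Rightarrow> real" where
  "gateaux_deriv f x v = deriv (\<lambda>t::real. f (x + t *\<^sub>R v)) 0"

definition gateaux_deriv2 :: "('a::real_normed_vector \<Rightarrow> real) \<Rightarrow> 'a \<Rightarrow> 'a \<Rightarrow> real" where
  "gateaux_deriv2 f x v = gateaux_deriv (\<lambda>y. gateaux_deriv f y v) x v"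

definition twice_gateaux_differentiable :: "('a::real_normed_vector \<Rightarrow> real) \<Rightarrow> 'a \<Rightarrow> 'a \<Rightarrow> bool" where
  "twice_gateaux_differentiable f x v \<longleftrightarrow>
     (\<forall>\<^sub>F s in nhds (0::real). gateaux_differentiable f (x + s *\<^sub>R v) v) \<and>
     gateaux_differentiable (\<lambda>y. gateaux_deriv f y v) x v"

text \<open>Functions on X = B(c) are represented as functions on the whole space that vanish outside X.\<close>
definition onX :: "real \<Rightarrow> ('a::real_normed_vector \<Rightarrow> real) \<Rightarrow> 'a \<Rightarrow> real" where
  "onX c f = (\<lambda>x. if norm x \<le> c then f x else 0)"

definition bounded_on_X :: "real \<Rightarrow> ('a::real_normed_vector \<Rightarrow> real) \<Rightarrow> bool" where
  "bounded_on_X c f \<longleftrightarrow> (\<forall>x. c < norm x \<longrightarrow> f x = 0) \<and> (\<exists>K. \<forall>x. norm x \<le> c \<longrightarrow> \<bar>f x\<bar> \<le> K)"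

definition C_space :: "real \<Rightarrow> ('a::real_normed_vector \<Rightarrow> real) set \<Rightarrow> (('a \<Rightarrow> real) \<Rightarrow> real) \<Rightarrow> bool" where
  "C_space c C Cn \<longleftrightarrow>
     (\<forall>f\<in>C. bounded_on_X c f) \<and>
     (\<lambda>_. 0) \<in> C \<and>
     (\<forall>f\<in>C. \<forall>g\<in>C. (\<lambda>x. f x + g x) \<in> C) \<and>
     (\<forall>f\<in>C. \<forall>a::real. (\<lambda>x. a * f x) \<in> C) \<and>
     (\<forall>F f. (\<forall>m. F m \<in> C) \<and> bounded_on_X c f \<and> uniform_limit (cball 0 c) F f sequentially
            \<longrightarrow> f \<in> C) \<and>
     (\<forall>f\<in>C. 0 \<le> Cn f) \<and>
     (\<forall>f\<in>C. \<forall>a::real. Cn (\<lambda>x. a * f x) = \<bar>a\<bar> * Cn f) \<and>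
     (\<forall>f\<in>C. \<forall>g\<in>C. Cn (\<lambda>x. f x + g x) \<le> Cn f + Cn g)"

definition nat_filt :: "'w measure \<Rightarrow> (nat \<Rightarrow> 'w \<Rightarrow> 'a::topological_space) \<Rightarrow> nat \<Rightarrow> 'w measure" where
  "nat_filt M X i = sigma (space M) (\<Union>j\<in>{1..i}. {X j -` A \<inter> space M | A. A \<in> sets borel})"

definition mixing_coeff :: "'w measure \<Rightarrow> (nat \<Rightarrow> 'w \<Rightarrow> 'a::topological_space) \<Rightarrow>
    ('a \<Rightarrow> real) set \<Rightarrow> (('a \<Rightarrow> real) \<Rightarrow> real) \<Rightarrow> nat \<Rightarrow> ereal" where
  "mixing_coeff M X C Cn k =
     (SUP p \<in> {(\<phi>, i). \<phi> \<in> C \<and> Cn \<phi> \<le> 1 \<and> 1 \<le> i}.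
        esssup M (\<lambda>\<omega>. ereal \<bar>real_cond_exp M (nat_filt M X (snd p)) (\<lambda>\<omega>'. fst p (X (snd p + k) \<omega>')) \<omega>
                       - integral\<^sup>L M (\<lambda>\<omega>'. fst p (X (snd p + k) \<omega>'))\<bar>))"

end

theory Submission
  imports Defs
begin

text \<open>
  This is Pinelis' martingale argument, run separately on each residue class of indices modulo k and
  then recombined by convexity of cosh. Since the norm is twice differentiable away from 0, adding a
  small increment z to x changes cosh (L * norm x) by a term linear in z plus a relative error
  B * (L * norm z)^2. Along one residue class an increment is k steps ahead of the past, so mixing bounds
  the conditional expectation of the linear term by C1 * Phi and the conditional second moment by
  sigma^2 + C2 * Phi. Iterating bounds the exponential moment of the block sum, and Markov's inequality
  with a suitable L concludes.
\<close>

text \<open>The norm is singular at 0: its second derivative is only bounded by a multiple of 1 /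
  \<open>norm x\<close>. Passing to \<open>cosh (L * norm x)\<close> cures this, because the norm's
  second derivative then appears multiplied by \<open>sinh (L * norm x)\<close>, which vanishes at 0
  fast enough to cancel the singularity, and the error is again a multiple of \<open>cosh\<close>.
  Only segments through 0 escape the calculus; there x and z are collinear and the addition formula
  of \<open>cosh\<close> gives the estimate directly. The second obstacle is that mixing controls a
  fixed functional s, whereas the derivative of the norm at a random partial sum is a random
  functional. It depends on that sum alone, so freezing the sum on its level sets leaves a fixed s
  and an event of the past. A class with m terms is run at L = \<theta> / m, which gives all classes
  a common exponential bound; the constraint \<theta> * c \<le> l keeps every scaled increment at
  most 1, where the quadratic bounds on \<open>exp\<close> and \<open>cosh\<close> hold with
  constant 1.\<close>

section \<open>Directional derivatives of the norm\<close>

lemma gateaux_has_real_derivative: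
  assumes "gateaux_differentiable f x v"
  shows "((\<lambda>t. f (x + t *\<^sub>R v)) has_real_derivative gateaux_deriv f x v) (at 0)"
  using assms unfolding gateaux_differentiable_def gateaux_deriv_def
  by (simp add: DERIV_deriv_iff_real_differentiable)

lemma gateaux_has_real_derivative_along:
  assumes "gateaux_differentiable f (x + t *\<^sub>R v) v"
  shows "((\<lambda>t. f (x + t *\<^sub>R v)) has_real_derivative gateaux_deriv f (x + t *\<^sub>R v) v) (at t)"
proof -
  have "((\<lambda>s. f (x + (s + t) *\<^sub>R v)) has_real_derivative gateaux_deriv f (x + t *\<^sub>R v) v) (at 0)"
    using gateaux_has_real_derivative[OF assms] by (simp add: algebra_simps)
  then show ?thesis
    using DERIV_shift[of "\<lambda>t. f (x + t *\<^sub>R v)" "gateaux_deriv f (x + t *\<^sub>R v) v" 0 t] by simp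
qed

lemma twice_gateaux_differentiableD:
  assumes "twice_gateaux_differentiable f x v"
  shows "gateaux_differentiable f x v"
    and "gateaux_differentiable (\<lambda>y. gateaux_deriv f y v) x v"
proof -
  have "\<forall>\<^sub>F s in nhds (0::real). gateaux_differentiable f (x + s *\<^sub>R v) v"
    using assms by (simp add: twice_gateaux_differentiable_def)
  from eventually_nhds_x_imp_x[OF this] show "gateaux_differentiable f x v" by simp
qed (use assms in \<open>simp add: twice_gateaux_differentiable_def\<close>)

text \<open>Right difference quotients already determine both derivatives. The comparison is asked
  only for 0 < t because the majorant \<open>norm x + t * norm v\<close> used below can fail for
  negative t.\<close>

lemma DERIV_at_0_le:
  fixes f g :: "real \<Rightarrow> real"
  assumes f: "(f has_real_derivative a) (at 0)" and g: "(g has_real_derivative b) (at 0)"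
    and le: "\<And>t. 0 < t \<Longrightarrow> f t \<le> g t" and eq: "f 0 = g 0"
  shows "a \<le> b"
proof -
  have "((\<lambda>h. (f (0 + h) - f 0) / h) \<longlongrightarrow> a) (at_right 0)"
    using f unfolding DERIV_def by (rule filterlim_at_split[THEN iffD1, THEN conjunct2])
  moreover have "((\<lambda>h. (g (0 + h) - g 0) / h) \<longlongrightarrow> b) (at_right 0)"
    using g unfolding DERIV_def by (rule filterlim_at_split[THEN iffD1, THEN conjunct2])
  moreover have "\<forall>\<^sub>F h in at_right 0. (f (0 + h) - f 0) / h \<le> (g (0 + h) - g 0) / h"
    using eventually_at_right_less[of "0::real"]
    by eventually_elim (use le eq in \<open>auto intro!: divide_right_mono\<close>)
  ultimately show ?thesis
    by (intro tendsto_le[OF trivial_limit_at_right_real])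
qed

text \<open>A two-sided directional derivative of a convex function is both sublinear and odd, hence linear.\<close>

lemma gateaux_deriv_norm_linear:
  fixes x :: "'a::real_normed_vector"
  assumes diff: "\<And>v. gateaux_differentiable norm x v"
  obtains s :: "'a \<Rightarrow>\<^sub>L real"
  where "norm s \<le> 1" "\<And>v. blinfun_apply s v = gateaux_deriv norm x v"
proof -
  let ?D = "gateaux_deriv norm x"
  note D = gateaux_has_real_derivative[OF diff]
  have scale: "?D (a *\<^sub>R v) = a * ?D v" for a v
  proof -
    have "((\<lambda>t. norm (x + (a * t) *\<^sub>R v)) has_real_derivative ?D v * a) (at 0)"
      by (rule DERIV_chain'[where f = "\<lambda>t. a * t" and g = "\<lambda>t. norm (x + t *\<^sub>R v)"])
        (auto intro!: derivative_eq_intros D)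
    moreover have "((\<lambda>t. norm (x + (a * t) *\<^sub>R v)) has_real_derivative ?D (a *\<^sub>R v)) (at 0)"
      using D[of "a *\<^sub>R v"] by (simp add: mult.commute)
    ultimately show ?thesis using DERIV_unique by (metis mult.commute)
  qed
  have sub: "?D (u + v) \<le> ?D u + ?D v" for u v
  proof -
    \<comment> \<open>Convexity enters at the midpoint of x + 2tu and x + 2tv; doubling the
      parameter compensates the factor 1/2.\<close>
    have half: "((\<lambda>t. norm (x + (2 * t) *\<^sub>R w) / 2) has_real_derivative ?D w) (at 0)" for w
    proof -
      have "((\<lambda>t. norm (x + (2 * t) *\<^sub>R w)) has_real_derivative ?D w * 2) (at 0)"
        by (rule DERIV_chain'[where f = "\<lambda>t. 2 * t" and g = "\<lambda>t. norm (x + t *\<^sub>R w)"])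
          (auto intro!: derivative_eq_intros D)
      from DERIV_cdivide[OF this, of 2] show ?thesis by simp
    qed
    show ?thesis
    proof (rule DERIV_at_0_le[OF D DERIV_add[OF half half]])
      fix t :: real
      have "x + t *\<^sub>R (u + v) = (1/2) *\<^sub>R ((x + (2*t) *\<^sub>R u) + (x + (2*t) *\<^sub>R v))"
        by (simp add: algebra_simps flip: scaleR_2)
      then show "norm (x + t *\<^sub>R (u + v)) \<le> norm (x + (2*t) *\<^sub>R u) / 2 + norm (x + (2*t) *\<^sub>R v) / 2"
        using norm_triangle_ineq[of "x + (2*t) *\<^sub>R u" "x + (2*t) *\<^sub>R v"] by simp
    qed simp
  qed
  have odd: "?D (- v) = - ?D v" for v using scale[of "-1" v] by simp
  \<comment> \<open>Subadditivity at the negated vectors, read through oddness, is the reverse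
    inequality.\<close>
  have add: "?D (u + v) = ?D u + ?D v" for u v
    using sub[of u v] sub[of "-u" "-v"] odd[of u] odd[of v] odd[of "u + v"] by simp
  have le: "?D v \<le> norm v" for v
  proof (rule DERIV_at_0_le[OF D])
    show "((\<lambda>t. norm x + t * norm v) has_real_derivative norm v) (at 0)"
      by (auto intro!: derivative_eq_intros)
    show "norm (x + t *\<^sub>R v) \<le> norm x + t * norm v" if "0 < t" for t
      using norm_triangle_ineq[of x "t *\<^sub>R v"] that by simp
  qed simp
  have abs: "\<bar>?D v\<bar> \<le> norm v" for v
    using le[of v] le[of "- v"] odd[of v] by simp
  have bl: "bounded_linear ?D"
    by (rule bounded_linear_intro[where K = 1]) (use add scale abs in auto)
  show thesis
  proof
    show "norm (Blinfun ?D) \<le> 1"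
      by (rule norm_blinfun_bound) (use abs in \<open>auto simp: bounded_linear_Blinfun_apply[OF bl]\<close>)
    show "blinfun_apply (Blinfun ?D) v = ?D v" for v
      by (simp add: bounded_linear_Blinfun_apply[OF bl])
  qed
qed

section \<open>Smoothness of \<open>cosh\<close> of the norm\<close>

lemma cosh_le_exp_times: "0 \<le> u \<Longrightarrow> 0 \<le> a \<Longrightarrow> cosh (a + u) \<le> cosh a * exp (u::real)"
  using mult_right_mono[OF sinh_le_cosh_real[of a], of "sinh u"]
  by (simp add: cosh_add sinh_plus_cosh[symmetric] algebra_simps)

text \<open>The difference of the two sides has derivative u * sinh u. At u = L *
  \<open>norm x\<close> the extra factor u cancels the 1 / \<open>norm x\<close> in the bound on the
  second derivative of the norm.\<close>

lemma sinh_le_mult_cosh: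
  assumes "0 \<le> (u::real)" shows "sinh u \<le> u * cosh u"
proof -
  have "0 * cosh 0 - sinh 0 \<le> u * cosh u - sinh u"
    by (rule DERIV_nonneg_imp_nondecreasing[OF assms])
      (auto intro!: exI derivative_eq_intros)
  then show ?thesis by simp
qed

lemma le_sinh: "0 \<le> u \<Longrightarrow> u \<le> sinh (u::real)"
  using real_le_x_sinh[of u] by (simp add: sinh_field_def exp_minus)

lemma cosh_le_1_plus_square:
  assumes "0 \<le> (u::real)" "u \<le> 1" shows "cosh u \<le> 1 + u\<^sup>2"
  using exp_bound[OF assms] le_sinh[OF assms(1)] sinh_plus_cosh[of u] by linarith

text \<open>With B = A1^2 + A2 and u = L * norm z, the function cosh (L * norm (x + t z)) of t has second
  derivative at most B * u^2 * cosh (L * norm x) * exp (t u); integrating twice gives the remainder.\<close>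

lemma cosh_norm_add_le_avoiding_0:
  fixes x z :: "'a::real_normed_vector"
  assumes A2_pos: "0 < A2" and L_pos: "0 < L"
    and twice: "\<And>x v :: 'a. x \<noteq> 0 \<Longrightarrow> twice_gateaux_differentiable norm x v"
    and d1: "\<And>x v :: 'a. x \<noteq> 0 \<Longrightarrow> \<bar>gateaux_deriv norm x v\<bar> \<le> A1 * norm v"
    and d2: "\<And>x v :: 'a. x \<noteq> 0 \<Longrightarrow> \<bar>gateaux_deriv2 norm x v\<bar> \<le> A2 * (norm v)\<^sup>2 / norm x"
    and avoid: "\<And>t. 0 \<le> t \<Longrightarrow> t \<le> 1 \<Longrightarrow> x + t *\<^sub>R z \<noteq> 0"
  shows "cosh (L * norm (x + z)) \<le> cosh (L * norm x) + L * sinh (L * norm x) * gateaux_deriv norm x z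
           + (A1\<^sup>2 + A2) * cosh (L * norm x) * (exp (L * norm z) - 1 - L * norm z)"
proof -
  define N where "N = (\<lambda>t. norm (x + t *\<^sub>R z))"
  define N1 where "N1 = (\<lambda>t. gateaux_deriv norm (x + t *\<^sub>R z) z)"
  define N2 where "N2 = (\<lambda>t. gateaux_deriv2 norm (x + t *\<^sub>R z) z)"
  define B where "B = A1\<^sup>2 + A2"
  define u where "u = L * norm z"
  \<comment> \<open>h is the claimed upper bound minus the actual value along the segment, with
    derivatives h1 and h2. Both h and h1 vanish at 0, so nonnegativity of h2 propagates up to h at
    1.\<close>
  define h where "h = (\<lambda>t. cosh (L * N 0) + t * (L * sinh (L * N 0) * N1 0)
      + B * cosh (L * N 0) * (exp (t * u) - 1 - t * u) - cosh (L * N t))"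
  define h1 where "h1 = (\<lambda>t. L * sinh (L * N 0) * N1 0
      + B * cosh (L * N 0) * (exp (t * u) * u - u) - L * sinh (L * N t) * N1 t)"
  define h2 where "h2 = (\<lambda>t. B * cosh (L * N 0) * exp (t * u) * u\<^sup>2
      - (L\<^sup>2 * cosh (L * N t) * (N1 t)\<^sup>2 + L * sinh (L * N t) * N2 t))"
  have DN: "(N has_real_derivative N1 t) (at t)" if "0 \<le> t" "t \<le> 1" for t
    unfolding N_def N1_def
    by (rule gateaux_has_real_derivative_along) (rule twice_gateaux_differentiableD(1)[OF twice[OF avoid[OF that]]])
  have DN1: "(N1 has_real_derivative N2 t) (at t)" if "0 \<le> t" "t \<le> 1" for t
    unfolding N1_def N2_def gateaux_deriv2_def
    by (rule gateaux_has_real_derivative_along) (rule twice_gateaux_differentiableD(2)[OF twice[OF avoid[OF that]]])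
  have Dh: "(h has_real_derivative h1 t) (at t)" if "0 \<le> t" "t \<le> 1" for t
    unfolding h_def h1_def
    by (auto intro!: derivative_eq_intros DN that simp: algebra_simps)
  have Dh1: "(h1 has_real_derivative h2 t) (at t)" if "0 \<le> t" "t \<le> 1" for t
    unfolding h1_def h2_def
    by (auto intro!: derivative_eq_intros DN DN1 that simp: algebra_simps power2_eq_square)
  have h2: "0 \<le> h2 t" if t: "0 \<le> t" "t \<le> 1" for t
  proof -
    have Npos: "0 < N t" using avoid[OF t] by (simp add: N_def)
    have N1sq: "(N1 t)\<^sup>2 \<le> A1\<^sup>2 * (norm z)\<^sup>2"
      using d1[OF avoid[OF t], of z] unfolding N1_def
      by (metis abs_le_square_iff abs_of_nonneg order_trans abs_ge_zero power_mult_distrib)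
    have "sinh (L * N t) * N2 t \<le> sinh (L * N t) * \<bar>N2 t\<bar>"
      using L_pos Npos by (intro mult_left_mono) auto
    also have "\<dots> \<le> (L * N t * cosh (L * N t)) * (A2 * (norm z)\<^sup>2 / N t)"
      using d2[OF avoid[OF t], of z] sinh_le_mult_cosh[of "L * N t"] L_pos Npos
      by (intro mult_mono') (auto simp: N_def N2_def)
    also have "\<dots> = L * cosh (L * N t) * A2 * (norm z)\<^sup>2"
      using Npos by simp
    finally have N2: "L * (sinh (L * N t) * N2 t) \<le> L * (L * cosh (L * N t) * A2 * (norm z)\<^sup>2)"
      using L_pos by (intro mult_left_mono) auto
    have "L\<^sup>2 * cosh (L * N t) * (N1 t)\<^sup>2 + L * sinh (L * N t) * N2 t
        \<le> L\<^sup>2 * cosh (L * N t) * (A1\<^sup>2 * (norm z)\<^sup>2) + L * (L * cosh (L * N t) * A2 * (norm z)\<^sup>2)"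
      using N2 N1sq by (intro add_mono mult_left_mono) (auto simp: mult.assoc)
    also have "\<dots> = B * u\<^sup>2 * cosh (L * N t)"
      by (simp add: B_def u_def power2_eq_square algebra_simps)
    also have "\<dots> \<le> B * u\<^sup>2 * (cosh (L * N 0) * exp (t * u))"
    proof (rule mult_left_mono)
      have "N t \<le> N 0 + t * norm z"
        using norm_triangle_ineq[of x "t *\<^sub>R z"] t by (simp add: N_def)
      then have "L * N t \<le> L * N 0 + t * u"
        using L_pos mult_left_mono[of "N t" "N 0 + t * norm z" L] by (simp add: u_def algebra_simps)
      then have "cosh (L * N t) \<le> cosh (L * N 0 + t * u)"
        using L_pos t by (subst cosh_real_nonneg_le_iff) (auto simp: u_def N_def)
      also have "\<dots> \<le> cosh (L * N 0) * exp (t * u)"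
        using L_pos t by (intro cosh_le_exp_times) (auto simp: u_def N_def)
      finally show "cosh (L * N t) \<le> cosh (L * N 0) * exp (t * u)" .
    qed (use A2_pos in \<open>auto simp: B_def\<close>)
    finally show ?thesis by (simp add: h2_def algebra_simps)
  qed
  have h1: "0 \<le> h1 t" if "0 \<le> t" "t \<le> 1" for t
  proof -
    have "h1 0 \<le> h1 t"
      by (rule DERIV_nonneg_imp_nondecreasing[OF that(1)]) (use that Dh1 h2 in force)
    then show ?thesis by (simp add: h1_def)
  qed
  have "h 0 \<le> h 1"
    by (rule DERIV_nonneg_imp_nondecreasing) (use Dh h1 in force)+
  then show ?thesis
    by (simp add: h_def N_def N1_def u_def B_def)
qed

text \<open>Away from 0, s is the derivative of the norm at x. It is chosen before z, hence depends
  only on the current state, which is what conditioning on the past requires. The restriction on z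
  turns the exponential remainder into a square.\<close>

lemma cosh_norm_add_le:
  fixes x :: "'a::real_normed_vector"
  assumes A1_ge: "1 \<le> A1" and A2_pos: "0 < A2" and L_pos: "0 < L"
    and twice: "\<And>x v :: 'a. x \<noteq> 0 \<Longrightarrow> twice_gateaux_differentiable norm x v"
    and d1: "\<And>x v :: 'a. x \<noteq> 0 \<Longrightarrow> \<bar>gateaux_deriv norm x v\<bar> \<le> A1 * norm v"
    and d2: "\<And>x v :: 'a. x \<noteq> 0 \<Longrightarrow> \<bar>gateaux_deriv2 norm x v\<bar> \<le> A2 * (norm v)\<^sup>2 / norm x"
  obtains s :: "'a \<Rightarrow>\<^sub>L real" where "norm s \<le> 1"
    "\<And>z. L * norm z \<le> 1 \<Longrightarrow> cosh (L * norm (x + z))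
       \<le> cosh (L * norm x) * (1 + (A1\<^sup>2 + A2) * (L * norm z)\<^sup>2) + L * sinh (L * norm x) * blinfun_apply s z"
proof -
  let ?B = "A1\<^sup>2 + A2"
  have B: "1 \<le> ?B" using one_le_power[OF A1_ge, of 2] A2_pos by linarith
  have quad: "cosh a * w\<^sup>2 \<le> ?B * cosh a * w\<^sup>2" for a w :: real
    using mult_right_mono[OF B, of "cosh a * w\<^sup>2"] by (simp add: mult.assoc)
  show thesis
  proof (cases "x = 0")
    case True
    \<comment> \<open>The linear term carries the factor sinh 0, so at the origin any s will do; s =
      0 is taken.\<close>
    have "cosh (L * norm z) \<le> 1 + ?B * (L * norm z)\<^sup>2" if "L * norm z \<le> 1" for z :: 'a
      using cosh_le_1_plus_square[of "L * norm z"] quad[of 0 "L * norm z"] that L_pos by simp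
    then show ?thesis using that[of 0] True by simp
  next
    case False
    obtain s :: "'a \<Rightarrow>\<^sub>L real" where s: "norm s \<le> 1" "\<And>v. blinfun_apply s v = gateaux_deriv norm x v"
      using gateaux_deriv_norm_linear[OF twice_gateaux_differentiableD(1)[OF twice[OF False]]] by blast
    show ?thesis
    proof (rule that[OF s(1)])
      fix z :: 'a assume z: "L * norm z \<le> 1"
      let ?u = "L * norm z" and ?a = "L * norm x"
      have u: "0 \<le> ?u" and a: "0 \<le> ?a" using L_pos by auto
      show "cosh (L * norm (x + z)) \<le> cosh ?a * (1 + ?B * ?u\<^sup>2) + L * sinh ?a * blinfun_apply s z"
      proof (cases "\<exists>t. 0 \<le> t \<and> t \<le> 1 \<and> x + t *\<^sub>R z = 0")
        case True
        then obtain t where t: "0 \<le> t" "t \<le> 1" "x + t *\<^sub>R z = 0" by blast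
        \<comment> \<open>The segment meets 0, so x and z point in opposite directions and
          \<open>norm (x + z)\<close> is exactly \<open>norm z - norm x\<close>. The addition
          formula then produces - u * sinh a, and no functional of norm at most 1 can make the
          linear term smaller than that.\<close>
        have x: "x = (- t) *\<^sub>R z" using t(3) by (simp add: eq_neg_iff_add_eq_0)
        have "x + z = (1 - t) *\<^sub>R z" unfolding x by (simp add: algebra_simps)
        then have "norm (x + z) = norm z - t * norm z"
          using t by (simp add: left_diff_distrib)
        moreover have "norm x = t * norm z" using x t by simp
        ultimately have "L * norm (x + z) = ?u - ?a"
          by (simp add: right_diff_distrib)
        then have "cosh (L * norm (x + z)) = cosh ?u * cosh ?a - sinh ?u * sinh ?a"
          by (simp add: cosh_diff)
        also have "\<dots> \<le> (1 + ?u\<^sup>2) * cosh ?a - ?u * sinh ?a"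
          using cosh_le_1_plus_square[OF u z] le_sinh[OF u] a
          by (intro diff_mono mult_right_mono) auto
        also have "\<dots> \<le> cosh ?a * (1 + ?B * ?u\<^sup>2) - ?u * sinh ?a"
          using quad[of ?a ?u] by (simp add: algebra_simps)
        also have "\<dots> \<le> cosh ?a * (1 + ?B * ?u\<^sup>2) + L * sinh ?a * blinfun_apply s z"
        proof -
          have "\<bar>blinfun_apply s z\<bar> \<le> norm z"
            using norm_blinfun[of s z] mult_right_mono[OF s(1), of "norm z"] by simp
          then have "(L * sinh ?a) * (- norm z) \<le> (L * sinh ?a) * blinfun_apply s z"
            using L_pos a by (intro mult_left_mono) auto
          then show ?thesis by (simp add: algebra_simps)
        qed
        finally show ?thesis .
      next
        case False
        have "exp ?u - 1 - ?u \<le> ?u\<^sup>2" using exp_bound[OF u z] by simp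
        then have "?B * cosh ?a * (exp ?u - 1 - ?u) \<le> ?B * cosh ?a * ?u\<^sup>2"
          using B by (intro mult_left_mono) auto
        moreover have "cosh (L * norm (x + z)) \<le> cosh ?a + L * sinh ?a * gateaux_deriv norm x z
            + ?B * cosh ?a * (exp ?u - 1 - ?u)"
          by (rule cosh_norm_add_le_avoiding_0[OF A2_pos L_pos twice d1 d2]) (use False in auto)
        ultimately show ?thesis by (simp add: s(2) algebra_simps)
      qed
    qed
  qed
qed

section \<open>One step of the exponential recursion\<close>

lemma sum_indicator_vimage_singleton:
  fixes g :: "'b \<Rightarrow> real"
  assumes "finite (T ` S)" "\<omega> \<in> S"
  shows "(\<Sum>v\<in>T ` S. indicator (T -` {v} \<inter> S) \<omega> * g v) = g (T \<omega>)"
proof -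
  have "(\<Sum>v\<in>T ` S. indicator (T -` {v} \<inter> S) \<omega> * g v) = (\<Sum>v\<in>T ` S. if v = T \<omega> then g v else 0)"
    by (rule sum.cong) (auto simp: indicator_def assms(2))
  then show ?thesis using assms by simp
qed

lemma borel_measurable_cosh [measurable (raw)]:
  fixes f :: "'a \<Rightarrow> real"
  assumes "f \<in> borel_measurable M"
  shows "(\<lambda>x. cosh (f x)) \<in> borel_measurable M"
  by (rule borel_measurable_continuous_on[OF _ assms]) (intro continuous_intros)

context prob_space
begin

lemma integrable_bounded:
  fixes f :: "'a \<Rightarrow> 'b::{banach, second_countable_topology}"
  assumes "f \<in> borel_measurable M" "\<And>\<omega>. \<omega> \<in> space M \<Longrightarrow> norm (f \<omega>) \<le> K"
  shows "integrable M f"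
  using assms by (intro integrable_const_bound[where B = K]) auto

text \<open>On a level set of T the functional supplied by \<open>smooth\<close> is constant, and
  the level set is an event of F, so \<open>drift\<close> and \<open>var\<close> apply level by
  level; finitely many levels are summed.\<close>

lemma expectation_cosh_norm_add_le_simple:
  fixes T Z :: "'a \<Rightarrow> 'b::{banach, second_countable_topology}"
  assumes sub: "subalgebra M F" and T: "simple_function F T" and Z [measurable]: "Z \<in> borel_measurable M"
    and Z_bound: "\<And>\<omega>. \<omega> \<in> space M \<Longrightarrow> L * norm (Z \<omega>) \<le> 1"
    and L_pos: "0 < L" and K: "0 \<le> K" and B: "0 \<le> B"
    and smooth: "\<And>x::'b. \<exists>s::'b \<Rightarrow>\<^sub>L real. norm s \<le> 1 \<and> (\<forall>z. L * norm z \<le> 1 \<longrightarrow>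
      cosh (L * norm (x + z)) \<le> cosh (L * norm x) * (1 + B * (L * norm z)\<^sup>2) + L * sinh (L * norm x) * blinfun_apply s z)"
    and drift: "\<And>A (s::'b \<Rightarrow>\<^sub>L real). A \<in> sets F \<Longrightarrow> norm s \<le> 1 \<Longrightarrow>
      expectation (\<lambda>\<omega>. indicator A \<omega> * blinfun_apply s (Z \<omega>)) \<le> K * prob A"
    and var: "\<And>A. A \<in> sets F \<Longrightarrow> expectation (\<lambda>\<omega>. indicator A \<omega> * (norm (Z \<omega>))\<^sup>2) \<le> W * prob A"
  shows "expectation (\<lambda>\<omega>. cosh (L * norm (T \<omega> + Z \<omega>)))
    \<le> (1 + L * K + L\<^sup>2 * B * W) * expectation (\<lambda>\<omega>. cosh (L * norm (T \<omega>)))"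
proof -
  obtain s :: "'b \<Rightarrow> 'b \<Rightarrow>\<^sub>L real" where s: "\<And>x. norm (s x) \<le> 1"
    "\<And>x z. L * norm z \<le> 1 \<Longrightarrow> cosh (L * norm (x + z))
      \<le> cosh (L * norm x) * (1 + B * (L * norm z)\<^sup>2) + L * sinh (L * norm x) * blinfun_apply (s x) z"
    using smooth by metis
  define V where "V = T ` space M"
  define A where "A = (\<lambda>v. T -` {v} \<inter> space M)"
  have sp: "space F = space M" using sub by (simp add: subalgebra_def)
  have V: "finite V" using simple_functionD(1)[OF T] by (simp add: V_def sp)
  have AF: "A v \<in> sets F" for v using simple_functionD(2)[OF T, of "{v}"] by (simp add: A_def sp)
  have AM [measurable]: "A v \<in> sets M" for v using AF sub by (auto simp: subalgebra_def)
  have TM [measurable]: "T \<in> borel_measurable M"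
    by (rule measurable_from_subalg[OF sub borel_measurable_simple_function[OF T]])
  have Zn: "norm (Z \<omega>) \<le> 1 / L" if "\<omega> \<in> space M" for \<omega>
    using Z_bound[OF that] L_pos by (simp add: field_simps)
  have sZ: "\<bar>blinfun_apply (s v) (Z \<omega>)\<bar> \<le> 1 / L" if "\<omega> \<in> space M" for v \<omega>
    using norm_blinfun[of "s v" "Z \<omega>"] mult_mono[OF s(1)[of v] Zn[OF that]] by simp
  have sM [measurable]: "(\<lambda>\<omega>. blinfun_apply (s v) (Z \<omega>)) \<in> borel_measurable M" for v
    by (rule borel_measurable_continuous_on[OF _ Z]) (intro continuous_intros)
  have i1: "integrable M (\<lambda>\<omega>. indicator (A v) \<omega> * blinfun_apply (s v) (Z \<omega>))" for v
    by (rule integrable_bounded[where K = "1 / L"]) (use sZ L_pos in \<open>auto simp: indicator_def\<close>)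
  have i2: "integrable M (\<lambda>\<omega>. indicator (A v) \<omega> * (norm (Z \<omega>))\<^sup>2)" for v
    by (rule integrable_bounded[where K = "(1 / L)\<^sup>2"])
      (use Zn in \<open>auto simp: indicator_def simp del: power_divide intro!: power_mono\<close>)
  have i3: "integrable M (\<lambda>\<omega>. indicator (A v) \<omega> :: real)" for v
    by (rule integrable_bounded[where K = 1]) (auto simp: indicator_def)
  define g where "g = (\<lambda>\<omega> v. cosh (L * norm v) * indicator (A v) \<omega>
      + cosh (L * norm v) * B * L\<^sup>2 * (indicator (A v) \<omega> * (norm (Z \<omega>))\<^sup>2)
      + L * sinh (L * norm v) * (indicator (A v) \<omega> * blinfun_apply (s v) (Z \<omega>)))"
  have ig: "integrable M (\<lambda>\<omega>. g \<omega> v)" for v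
    unfolding g_def using i1 i2 i3 by (intro Bochner_Integration.integrable_add integrable_mult_right)
  have pw: "cosh (L * norm (T \<omega> + Z \<omega>)) \<le> (\<Sum>v\<in>V. g \<omega> v)" if "\<omega> \<in> space M" for \<omega>
  proof -
    have "(\<Sum>v\<in>V. g \<omega> v) = (\<Sum>v\<in>V. indicator (A v) \<omega> * (cosh (L * norm v) * (1 + B * (L * norm (Z \<omega>))\<^sup>2)
         + L * sinh (L * norm v) * blinfun_apply (s v) (Z \<omega>)))"
      by (rule sum.cong) (auto simp: g_def algebra_simps power_mult_distrib)
    also have "\<dots> = cosh (L * norm (T \<omega>)) * (1 + B * (L * norm (Z \<omega>))\<^sup>2)
         + L * sinh (L * norm (T \<omega>)) * blinfun_apply (s (T \<omega>)) (Z \<omega>)"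
      unfolding A_def V_def by (rule sum_indicator_vimage_singleton) (use V that in \<open>auto simp: V_def\<close>)
    finally show ?thesis using s(2)[OF Z_bound[OF that], of "T \<omega>"] by simp
  qed
  have "expectation (\<lambda>\<omega>. cosh (L * norm (T \<omega> + Z \<omega>))) \<le> expectation (\<lambda>\<omega>. \<Sum>v\<in>V. g \<omega> v)"
    by (rule integral_mono') (use ig in \<open>auto intro: pw order_trans[OF cosh_real_nonneg pw]\<close>)
  also have "\<dots> = (\<Sum>v\<in>V. expectation (\<lambda>\<omega>. g \<omega> v))"
    by (rule Bochner_Integration.integral_sum) (rule ig)
  also have "\<dots> \<le> (\<Sum>v\<in>V. (1 + L * K + L\<^sup>2 * B * W) * (cosh (L * norm v) * prob (A v)))"
  proof (rule sum_mono)
    fix v :: 'b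
    let ?c = "cosh (L * norm v)"
    have "expectation (\<lambda>\<omega>. g \<omega> v) = ?c * prob (A v)
        + ?c * B * L\<^sup>2 * expectation (\<lambda>\<omega>. indicator (A v) \<omega> * (norm (Z \<omega>))\<^sup>2)
        + L * sinh (L * norm v) * expectation (\<lambda>\<omega>. indicator (A v) \<omega> * blinfun_apply (s v) (Z \<omega>))"
      unfolding g_def using i1 i2 i3 AM[of v, THEN sets.sets_into_space]
      by (simp add: Int_absorb2)
    also have "\<dots> \<le> ?c * prob (A v) + ?c * B * L\<^sup>2 * (W * prob (A v)) + L * sinh (L * norm v) * (K * prob (A v))"
      using var[OF AF] drift[OF AF s(1)] L_pos B by (intro add_mono mult_left_mono) auto
    \<comment> \<open>Replacing sinh by cosh, legitimate since K is nonnegative, makes the drift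
      proportional to the quantity being iterated, so the recursion closes with a constant
      factor.\<close>
    also have "\<dots> \<le> ?c * prob (A v) + ?c * B * L\<^sup>2 * (W * prob (A v)) + L * ?c * (K * prob (A v))"
      using L_pos K sinh_le_cosh_real by (intro add_left_mono mult_right_mono mult_left_mono) auto
    finally show "expectation (\<lambda>\<omega>. g \<omega> v) \<le> (1 + L * K + L\<^sup>2 * B * W) * (?c * prob (A v))"
      by (simp add: algebra_simps)
  qed
  also have "\<dots> = (1 + L * K + L\<^sup>2 * B * W) * expectation (\<lambda>\<omega>. cosh (L * norm (T \<omega>)))"
  proof -
    have "expectation (\<lambda>\<omega>. cosh (L * norm (T \<omega>)))
        = expectation (\<lambda>\<omega>. \<Sum>v\<in>V. indicator (A v) \<omega> * cosh (L * norm v))"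
      unfolding A_def V_def
      by (rule Bochner_Integration.integral_cong[OF refl], subst sum_indicator_vimage_singleton)
        (use V in \<open>auto simp: V_def\<close>)
    also have "\<dots> = (\<Sum>v\<in>V. cosh (L * norm v) * prob (A v))"
      using i3 AM[THEN sets.sets_into_space] by (simp add: Int_absorb2 mult.commute)
    finally show ?thesis by (simp add: sum_distrib_left)
  qed
  finally show ?thesis .
qed

text \<open>Approximating S by simple functions avoids having to choose the derivative of the norm
  at S measurably.\<close>

lemma expectation_cosh_norm_add_le:
  fixes S Z :: "'a \<Rightarrow> 'b::{banach, second_countable_topology}"
  assumes sub: "subalgebra M F" and S: "S \<in> borel_measurable F" and Z [measurable]: "Z \<in> borel_measurable M"
    and S_bound: "\<And>\<omega>. \<omega> \<in> space M \<Longrightarrow> norm (S \<omega>) \<le> R"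
    and Z_bound: "\<And>\<omega>. \<omega> \<in> space M \<Longrightarrow> L * norm (Z \<omega>) \<le> 1"
    and L_pos: "0 < L" and K: "0 \<le> K" and B: "0 \<le> B"
    and smooth: "\<And>x::'b. \<exists>s::'b \<Rightarrow>\<^sub>L real. norm s \<le> 1 \<and> (\<forall>z. L * norm z \<le> 1 \<longrightarrow>
      cosh (L * norm (x + z)) \<le> cosh (L * norm x) * (1 + B * (L * norm z)\<^sup>2) + L * sinh (L * norm x) * blinfun_apply s z)"
    and drift: "\<And>A (s::'b \<Rightarrow>\<^sub>L real). A \<in> sets F \<Longrightarrow> norm s \<le> 1 \<Longrightarrow>
      expectation (\<lambda>\<omega>. indicator A \<omega> * blinfun_apply s (Z \<omega>)) \<le> K * prob A"
    and var: "\<And>A. A \<in> sets F \<Longrightarrow> expectation (\<lambda>\<omega>. indicator A \<omega> * (norm (Z \<omega>))\<^sup>2) \<le> W * prob A"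
  shows "expectation (\<lambda>\<omega>. cosh (L * norm (S \<omega> + Z \<omega>)))
    \<le> (1 + L * K + L\<^sup>2 * B * W) * expectation (\<lambda>\<omega>. cosh (L * norm (S \<omega>)))"
proof -
  have sp: "space F = space M" using sub by (simp add: subalgebra_def)
  have SM [measurable]: "S \<in> borel_measurable M" by (rule measurable_from_subalg[OF sub S])
  \<comment> \<open>The bound by twice the norm of S gives the constant dominating functions for
    both limits.\<close>
  obtain T where T: "\<And>i. simple_function F (T i)" "\<And>x. x \<in> space M \<Longrightarrow> (\<lambda>i. T i x) \<longlonglongrightarrow> S x"
    "\<And>i x. x \<in> space M \<Longrightarrow> dist (T i x) 0 \<le> 2 * dist (S x) 0"
    using borel_measurable_implies_sequence_metric[OF S, of 0] unfolding sp by metis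
  have TM [measurable]: "T i \<in> borel_measurable M" for i
    by (rule measurable_from_subalg[OF sub borel_measurable_simple_function[OF T(1)]])
  have T_bound: "L * norm (T i \<omega>) \<le> 2 * L * R" if "\<omega> \<in> space M" for i \<omega>
    using T(3)[OF that, of i] S_bound[OF that] L_pos mult_left_mono[of "norm (T i \<omega>)" "2 * R" L] by simp
  have lim1: "(\<lambda>i. expectation (\<lambda>\<omega>. cosh (L * norm (T i \<omega> + Z \<omega>))))
      \<longlonglongrightarrow> expectation (\<lambda>\<omega>. cosh (L * norm (S \<omega> + Z \<omega>)))"
  proof (rule integral_dominated_convergence[where w = "\<lambda>_. cosh (2 * L * R + 1)"])
    show "AE \<omega> in M. norm (cosh (L * norm (T i \<omega> + Z \<omega>))) \<le> cosh (2 * L * R + 1)" for i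
    proof (rule AE_I2)
      fix \<omega> assume w: "\<omega> \<in> space M"
      have "L * norm (T i \<omega> + Z \<omega>) \<le> L * norm (T i \<omega>) + L * norm (Z \<omega>)"
        using norm_triangle_ineq[of "T i \<omega>" "Z \<omega>"] L_pos by (simp flip: distrib_left)
      then have le: "L * norm (T i \<omega> + Z \<omega>) \<le> 2 * L * R + 1"
        using T_bound[OF w, of i] Z_bound[OF w] by simp
      moreover have "0 \<le> L * norm (T i \<omega> + Z \<omega>)" using L_pos by simp
      ultimately show "norm (cosh (L * norm (T i \<omega> + Z \<omega>))) \<le> cosh (2 * L * R + 1)"
        by (simp add: cosh_real_nonneg_le_iff)
    qed
  qed (auto intro!: AE_I2 tendsto_intros T(2))
  have lim2: "(\<lambda>i. expectation (\<lambda>\<omega>. cosh (L * norm (T i \<omega>)))) \<longlonglongrightarrow> expectation (\<lambda>\<omega>. cosh (L * norm (S \<omega>)))"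
  proof (rule integral_dominated_convergence[where w = "\<lambda>_. cosh (2 * L * R)"])
    show "AE \<omega> in M. norm (cosh (L * norm (T i \<omega>))) \<le> cosh (2 * L * R)" for i
    proof (rule AE_I2)
      fix \<omega> assume w: "\<omega> \<in> space M"
      have "0 \<le> L * norm (T i \<omega>)" using L_pos by simp
      then show "norm (cosh (L * norm (T i \<omega>))) \<le> cosh (2 * L * R)"
        using T_bound[OF w, of i] by (simp add: cosh_real_nonneg_le_iff)
    qed
  qed (auto intro!: AE_I2 tendsto_intros T(2))
  show ?thesis
    by (rule LIMSEQ_le[OF lim1 tendsto_mult_left[OF lim2]])
      (use expectation_cosh_norm_add_le_simple[OF sub T(1) Z Z_bound L_pos K B smooth drift var] in blast)
qed

end

section \<open>The natural filtration\<close>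

lemma subalgebra_nat_filt:
  assumes "\<And>i. 1 \<le> i \<Longrightarrow> X i \<in> borel_measurable M"
  shows "subalgebra M (nat_filt M X i)"
proof -
  have "(\<Union>j\<in>{1..i}. {X j -` A \<inter> space M | A. A \<in> sets borel}) \<subseteq> sets M"
    using assms by (auto intro: measurable_sets)
  then show ?thesis
    unfolding subalgebra_def nat_filt_def
    by (simp add: space_measure_of_conv sets_measure_of_conv sets.sigma_sets_subset)
qed

lemma measurable_nat_filt:
  assumes "1 \<le> j" "j \<le> i"
  shows "X j \<in> borel_measurable (nat_filt M X i)"
proof (rule measurableI)
  fix A :: "'b set" assume "A \<in> sets borel"
  then show "X j -` A \<inter> space (nat_filt M X i) \<in> sets (nat_filt M X i)"
    using assms unfolding nat_filt_def space_measure_of_conv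
    by (intro in_measure_of) (auto intro!: bexI[of _ j])
qed simp

text \<open>Index 0 serves as the empty past of the first term of a residue class.\<close>

lemma sets_nat_filt_0: "sets (nat_filt M X 0) = {{}, space M}"
  by (simp add: nat_filt_def sigma_sets_empty_eq)

section \<open>Residue classes and the choice of the exponential parameter\<close>

lemma sum_residue_blocks:
  fixes f :: "nat \<Rightarrow> 'a::comm_monoid_add"
  assumes "r \<le> k"
  shows "(\<Sum>j = 1..l * k + r. f j) = (\<Sum>i = 1..k. \<Sum>a<(if i \<le> r then Suc l else l). f (i + a * k))"
proof -
  \<comment> \<open>The indices form l full rows of length k and a last row of length r. Reading by
    columns gives the classes, and the first r columns are one term longer.\<close>
  have 1: "(\<Sum>j = 1..l * k + r. f j) = (\<Sum>j<l * k. f (Suc j)) + (\<Sum>i=1..r. f (i + l * k))"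
    using sum.ub_add_nat[of 1 "l * k" f r] sum.shift_bounds_cl_nat_ivl[of f 1 "l * k" r]
    by (simp add: sum.atLeast1_atMost_eq add.commute)
  have 2: "(\<Sum>j<l * k. f (Suc j)) = (\<Sum>i = 1..k. \<Sum>a<l. f (i + a * k))"
  proof -
    have "(\<Sum>j<l * k. f (Suc j)) = (\<Sum>a<l. \<Sum>j = a * k..<a * k + k. f (Suc j))"
      by (rule sum.nat_group[symmetric])
    also have "\<dots> = (\<Sum>a<l. \<Sum>i = 1..k. f (i + a * k))"
    proof (rule sum.cong[OF refl])
      fix a
      show "(\<Sum>j = a * k..<a * k + k. f (Suc j)) = (\<Sum>i = 1..k. f (i + a * k))"
        using sum.shift_bounds_nat_ivl[of "\<lambda>j. f (Suc j)" 0 "a * k" k]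
        by (simp add: sum.atLeast1_atMost_eq add.commute[of k] atLeast0LessThan)
    qed
    also have "\<dots> = (\<Sum>i = 1..k. \<Sum>a<l. f (i + a * k))"
      by (rule sum.swap)
    finally show ?thesis .
  qed
  have 3: "(\<Sum>i=1..r. f (i + l * k)) = (\<Sum>i=1..k. if i \<le> r then f (i + l * k) else 0)"
    using assms by (simp add: sum.If_cases Int_def) (rule sum.cong, auto)
  show ?thesis
    unfolding 1 2 3 sum.distrib[symmetric] by (rule sum.cong) auto
qed

lemma convex_on_cosh: "convex_on UNIV (cosh :: real \<Rightarrow> real)"
  by (rule convex_on_realI[where f' = sinh]) (auto intro!: derivative_eq_intros)

text \<open>This is the usual two-regime choice: the parameter that balances the quadratic term if
  the constraint \<theta> * c \<le> l permits it, otherwise the largest permitted one.\<close>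

lemma Bernstein_exponent:
  fixes K V \<nu> c l t :: real
  assumes K: "0 \<le> K" and V: "0 < V" and \<nu>: "0 < \<nu>" and c: "0 < c" and l: "0 < l"
    and t: "K + 4 * sqrt (V * \<nu> / l) + 4 * c * \<nu> / (3 * l) \<le> t"
  obtains \<theta> where "0 < \<theta>" "\<theta> * c \<le> l" "\<theta> * K + \<theta>\<^sup>2 * V / l - \<theta> * t \<le> - \<nu>"
proof -
  \<comment> \<open>At this w the quadratic term equals \<nu> and the square-root part of w * t is 4
    * \<nu>, which leaves room to spare.\<close>
  define w where "w = sqrt (l * \<nu> / V)"
  have w: "0 < w" "w\<^sup>2 = l * \<nu> / V" using assms by (auto simp: w_def)
  have "(w * V / l)\<^sup>2 = V * \<nu> / l"
    unfolding power_divide power_mult_distrib w(2) using V l by (simp add: field_simps power2_eq_square)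
  then have sq: "sqrt (V * \<nu> / l) = w * V / l"
    using w V l by (intro real_sqrt_unique) auto
  show thesis
  proof (cases "w * c \<le> l")
    case True
    have quad: "w\<^sup>2 * V / l = \<nu>"
      using w(2) V l by (simp add: field_simps)
    then have "w * K + 4 * \<nu> = w * (K + 4 * (w * V / l))"
      by (simp add: distrib_left power2_eq_square mult.assoc flip: quad)
    also have "\<dots> \<le> w * t"
      using t w c \<nu> l unfolding sq by (intro mult_left_mono) (auto intro: order_trans[rotated])
    finally have "w * K + w\<^sup>2 * V / l - w * t \<le> - \<nu>"
      unfolding quad using \<nu> by linarith
    then show thesis by (rule that[OF w(1) True])
  next
    case False
    \<comment> \<open>Now \<theta> = l / c < w. The square-root part of the threshold absorbs the
      quadratic term, and the linear part alone contributes 4 * \<nu> / 3.\<close>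
    have "l / c * K + 4 * (w * V / c) + 4 * \<nu> / 3 = l / c * (K + 4 * (w * V / l) + 4 * c * \<nu> / (3 * l))"
      using c l by (simp add: field_simps)
    also have "\<dots> \<le> l / c * t"
      using t c l unfolding sq by (intro mult_left_mono) auto
    finally have 1: "l / c * K + 4 * (w * V / c) + 4 * \<nu> / 3 \<le> l / c * t" .
    have "(l / c) * (V / c) \<le> w * (V / c)"
      using False c V by (intro mult_right_mono) (auto simp: field_simps)
    then have 2: "(l / c)\<^sup>2 * V / l \<le> w * V / c"
      using c l by (simp add: field_simps power2_eq_square)
    have 3: "0 \<le> w * V / c" using w c V by simp
    have "p + x - y \<le> - \<nu>" if "p + 4 * q + 4 * \<nu> / 3 \<le> y" "x \<le> q" "0 \<le> q" for p q x y
      using that \<nu> by linarith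
    from this[OF 1 2 3] have "l / c * K + (l / c)\<^sup>2 * V / l - l / c * t \<le> - \<nu>" .
    then show thesis using that[of "l / c"] c l by simp
  qed
qed

section \<open>Consequences of mixing at lag k\<close>

locale C_mixing_process = prob_space M
  for M :: "'w measure" +
  fixes X :: "nat \<Rightarrow> 'w \<Rightarrow> 'b::{banach, second_countable_topology}"
    and C :: "('b \<Rightarrow> real) set" and Cn :: "('b \<Rightarrow> real) \<Rightarrow> real"
    and c :: real and k :: nat
  assumes X_meas: "\<And>i. 1 \<le> i \<Longrightarrow> X i \<in> borel_measurable M"
    and X_bound: "\<And>i \<omega>. 1 \<le> i \<Longrightarrow> \<omega> \<in> space M \<Longrightarrow> norm (X i \<omega>) \<le> c"
    and C_space: "C_space c C Cn"
    and C_meas: "\<And>\<phi>. \<phi> \<in> C \<Longrightarrow> \<phi> \<in> borel_measurable borel"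
    and Phi_finite: "mixing_coeff M X C Cn k \<noteq> \<infinity>"
begin

text \<open>\<open>real_of_ereal\<close> sends both infinities to 0. \<open>Phi_finite\<close>
  excludes the positive one and the next lemma the negative one, so this is the genuine
  coefficient.\<close>

definition \<Phi> :: real where "\<Phi> = real_of_ereal (mixing_coeff M X C Cn k)"

lemma cond_exp_deviation:
  assumes "\<phi> \<in> C" "Cn \<phi> \<le> 1" "1 \<le> i"
  shows "AE \<omega> in M. \<bar>real_cond_exp M (nat_filt M X i) (\<lambda>\<omega>'. \<phi> (X (i + k) \<omega>')) \<omega>
           - expectation (\<lambda>\<omega>'. \<phi> (X (i + k) \<omega>'))\<bar> \<le> \<Phi>"
proof -
  let ?d = "\<lambda>\<omega>. \<bar>real_cond_exp M (nat_filt M X i) (\<lambda>\<omega>'. \<phi> (X (i + k) \<omega>')) \<omega>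
           - expectation (\<lambda>\<omega>'. \<phi> (X (i + k) \<omega>'))\<bar>"
  have le: "esssup M (\<lambda>\<omega>. ereal (?d \<omega>)) \<le> mixing_coeff M X C Cn k"
    unfolding mixing_coeff_def by (rule SUP_upper2[of "(\<phi>, i)"]) (use assms in auto)
  have ae: "AE \<omega> in M. ereal (?d \<omega>) \<le> mixing_coeff M X C Cn k"
    by (rule eventually_mono[OF esssup_AE]) (rule order_trans[OF _ le])
  \<comment> \<open>The coefficient dominates a real-valued function almost everywhere on a space of
    positive measure.\<close>
  have "mixing_coeff M X C Cn k \<noteq> - \<infinity>"
  proof
    assume "mixing_coeff M X C Cn k = - \<infinity>"
    with ae have "AE \<omega> in M. False" by simp
    then show False by simp
  qed
  with Phi_finite have Phi: "mixing_coeff M X C Cn k = ereal \<Phi>"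
    unfolding \<Phi>_def by (cases "mixing_coeff M X C Cn k") auto
  from ae show ?thesis unfolding Phi by simp
qed

lemma zero_in_C: "(\<lambda>_. 0) \<in> C" "Cn (\<lambda>_. 0) = 0"
proof -
  show z: "(\<lambda>_. 0) \<in> C" using C_space unfolding C_space_def by blast
  have "\<forall>f\<in>C. \<forall>a::real. Cn (\<lambda>x. a * f x) = \<bar>a\<bar> * Cn f"
    using C_space unfolding C_space_def by blast
  from this[rule_format, OF z, of 0] show "Cn (\<lambda>_. 0) = 0" by simp
qed

text \<open>The zero function is an admissible test function, so \<Phi> dominates an absolute
  value.\<close>

lemma Phi_nonneg: "0 \<le> \<Phi>"
proof -
  have "AE \<omega> in M. 0 \<le> \<Phi>"
    using cond_exp_deviation[OF zero_in_C(1) _ order_refl, unfolded zero_in_C(2), OF zero_le_one]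
    by eventually_elim (rule order_trans[OF abs_ge_zero])
  then show ?thesis by simp
qed

lemma sigma_finite_subalgebra_nat_filt: "sigma_finite_subalgebra M (nat_filt M X i)"
proof -
  interpret finite_measure_subalgebra M "nat_filt M X i"
    by unfold_locales (rule subalgebra_nat_filt[OF X_meas])
  show ?thesis by unfold_locales
qed

lemma integrable_C:
  assumes "\<phi> \<in> C" "1 \<le> i"
  shows "integrable M (\<lambda>\<omega>. \<phi> (X i \<omega>))"
proof -
  obtain B where "\<And>x. norm x \<le> c \<Longrightarrow> \<bar>\<phi> x\<bar> \<le> B"
    using C_space assms(1) unfolding C_space_def bounded_on_X_def by blast
  then show ?thesis
    using measurable_compose[OF X_meas[OF assms(2)] C_meas[OF assms(1)]] X_bound[OF assms(2)]
    by (intro integrable_bounded[where K = B]) auto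
qed

text \<open>Integrating over past events converts the almost sure bound on the conditional
  expectation into an inequality between integrals, the form that the level-set argument
  consumes.\<close>

lemma mixing_le_unit:
  assumes \<phi>: "\<phi> \<in> C" "Cn \<phi> \<le> 1" and i: "1 \<le> i" and A: "A \<in> sets (nat_filt M X i)"
  shows "expectation (\<lambda>\<omega>. indicator A \<omega> * \<phi> (X (i + k) \<omega>))
     \<le> (expectation (\<lambda>\<omega>. \<phi> (X (i + k) \<omega>)) + \<Phi>) * prob A"
proof -
  interpret sigma_finite_subalgebra M "nat_filt M X i"
    by (rule sigma_finite_subalgebra_nat_filt)
  let ?f = "\<lambda>\<omega>. \<phi> (X (i + k) \<omega>)"
  have f: "integrable M ?f" using integrable_C[OF \<phi>(1)] i by simp
  have AM [measurable]: "A \<in> sets M" using A subalg by (auto simp: subalgebra_def)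
  have "expectation (\<lambda>\<omega>. indicator A \<omega> * ?f \<omega>)
      = expectation (\<lambda>\<omega>. indicator A \<omega> * real_cond_exp M (nat_filt M X i) ?f \<omega>)"
    using real_cond_exp_intA[OF f A] by (simp add: set_lebesgue_integral_def)
  also have "\<dots> \<le> expectation (\<lambda>\<omega>. indicator A \<omega> * (expectation ?f + \<Phi>))"
  proof (rule integral_mono_AE)
    show "integrable M (\<lambda>\<omega>. indicator A \<omega> * real_cond_exp M (nat_filt M X i) ?f \<omega>)"
      using integrable_mult_indicator[OF AM real_cond_exp_int(1)[OF f]] by simp
    show "integrable M (\<lambda>\<omega>. indicator A \<omega> * (expectation ?f + \<Phi>))"
      by (rule integrable_bounded[where K = "\<bar>expectation ?f + \<Phi>\<bar>"]) (auto simp: indicator_def)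
    show "AE \<omega> in M. indicator A \<omega> * real_cond_exp M (nat_filt M X i) ?f \<omega> \<le> indicator A \<omega> * (expectation ?f + \<Phi>)"
      using cond_exp_deviation[OF \<phi> i] by eventually_elim (auto simp: indicator_def)
  qed
  also have "\<dots> = (expectation ?f + \<Phi>) * prob A"
    using AM[THEN sets.sets_into_space] by (simp add: Int_absorb2 mult.commute)
  finally show ?thesis .
qed

text \<open>If a = 0, then phi cannot be normalised by a; hence the passage to the limit from larger b.\<close>

lemma mixing_le:
  assumes \<phi>: "\<phi> \<in> C" "Cn \<phi> \<le> a" and a: "0 \<le> a" and i: "1 \<le> i" and A: "A \<in> sets (nat_filt M X i)"
  shows "expectation (\<lambda>\<omega>. indicator A \<omega> * \<phi> (X (i + k) \<omega>))
     \<le> (expectation (\<lambda>\<omega>. \<phi> (X (i + k) \<omega>)) + a * \<Phi>) * prob A"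
proof -
  let ?I = "expectation (\<lambda>\<omega>. indicator A \<omega> * \<phi> (X (i + k) \<omega>))" and ?E = "expectation (\<lambda>\<omega>. \<phi> (X (i + k) \<omega>))"
  have *: "?I \<le> (?E + b * \<Phi>) * prob A" if b: "a < b" for b
  proof -
    have "0 < b" using a b by simp
    have "(\<lambda>x. (1 / b) * \<phi> x) \<in> C" "Cn (\<lambda>x. (1 / b) * \<phi> x) = \<bar>1 / b\<bar> * Cn \<phi>"
      using C_space \<phi>(1) unfolding C_space_def by blast+
    moreover have "\<bar>1 / b\<bar> * Cn \<phi> \<le> 1" using \<phi>(2) b \<open>0 < b\<close> by (simp add: field_simps)
    ultimately have "expectation (\<lambda>\<omega>. indicator A \<omega> * ((1 / b) * \<phi> (X (i + k) \<omega>)))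
        \<le> (expectation (\<lambda>\<omega>. (1 / b) * \<phi> (X (i + k) \<omega>)) + \<Phi>) * prob A"
      using i A by (intro mixing_le_unit) auto
    moreover have "expectation (\<lambda>\<omega>. indicator A \<omega> * ((1 / b) * \<phi> (X (i + k) \<omega>))) = ?I / b"
      by (simp flip: Bochner_Integration.integral_divide_zero)
    ultimately have "?I / b \<le> (?E / b + \<Phi>) * prob A" by simp
    then have "?I \<le> (?E / b + \<Phi>) * prob A * b"
      using \<open>0 < b\<close> by (simp add: pos_divide_le_eq)
    also have "\<dots> = (?E + b * \<Phi>) * prob A"
      using \<open>0 < b\<close> by (simp add: field_simps)
    finally show ?thesis .
  qed
  show ?thesis
  proof (rule tendsto_le[of "at_right a" "\<lambda>b. (?E + b * \<Phi>) * prob A" _ "\<lambda>_. ?I"])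
    show "((\<lambda>b. (?E + b * \<Phi>) * prob A) \<longlongrightarrow> (?E + a * \<Phi>) * prob A) (at_right a)"
      by (intro tendsto_intros)
    show "\<forall>\<^sub>F b in at_right a. ?I \<le> (?E + b * \<Phi>) * prob A"
      using eventually_at_right_less[of a] by eventually_elim (rule *)
  qed auto
qed

section \<open>Exponential moment of one residue class\<close>

lemma block_exponential_moment:
  fixes L K B W :: real
  assumes L_pos: "0 < L" and Lc: "L * c \<le> 1" and K: "0 \<le> K" and B: "0 \<le> B" and W: "0 \<le> W"
    and smooth: "\<And>x::'b. \<exists>s::'b \<Rightarrow>\<^sub>L real. norm s \<le> 1 \<and> (\<forall>z. L * norm z \<le> 1 \<longrightarrow>
      cosh (L * norm (x + z)) \<le> cosh (L * norm x) * (1 + B * (L * norm z)\<^sup>2) + L * sinh (L * norm x) * blinfun_apply s z)"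
    and centered: "\<And>i. 1 \<le> i \<Longrightarrow> expectation (X i) = 0"
    and second_moment: "\<And>i. 1 \<le> i \<Longrightarrow> expectation (\<lambda>\<omega>. (norm (X i \<omega>))\<^sup>2) \<le> W"
    and drift: "\<And>i A (s::'b \<Rightarrow>\<^sub>L real). 1 \<le> i \<Longrightarrow> A \<in> sets (nat_filt M X i) \<Longrightarrow> norm s \<le> 1 \<Longrightarrow>
      expectation (\<lambda>\<omega>. indicator A \<omega> * blinfun_apply s (X (i + k) \<omega>)) \<le> K * prob A"
    and var: "\<And>i A. 1 \<le> i \<Longrightarrow> A \<in> sets (nat_filt M X i) \<Longrightarrow>
      expectation (\<lambda>\<omega>. indicator A \<omega> * (norm (X (i + k) \<omega>))\<^sup>2) \<le> W * prob A"
    and i: "1 \<le> i"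
  shows "expectation (\<lambda>\<omega>. cosh (L * norm (\<Sum>a<m. X (i + a * k) \<omega>))) \<le> (1 + L * K + L\<^sup>2 * B * W) ^ m"
proof (induction m)
  case 0
  show ?case by (simp add: prob_space)
next
  case (Suc m)
  \<comment> \<open>The past ends at the last index already summed, exactly k before the new one.
    For m = 0 there is no such index: the past is trivial, and centering and the plain second moment
    replace mixing.\<close>
  define F where "F = nat_filt M X (if m = 0 then 0 else i + (m - 1) * k)"
  let ?S = "\<lambda>\<omega>. \<Sum>a<m. X (i + a * k) \<omega>"
  have next_index: "i + (m - 1) * k + k = i + m * k" if "m \<noteq> 0"
    using that by (cases m) auto
  have ind_cong: "expectation (\<lambda>\<omega>. indicator (space M) \<omega> * f \<omega>) = expectation f" for f :: "'w \<Rightarrow> real"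
    by (rule Bochner_Integration.integral_cong) auto
  have "expectation (\<lambda>\<omega>. cosh (L * norm (?S \<omega> + X (i + m * k) \<omega>)))
      \<le> (1 + L * K + L\<^sup>2 * B * W) * expectation (\<lambda>\<omega>. cosh (L * norm (?S \<omega>)))"
  proof (rule expectation_cosh_norm_add_le[OF _ _ _ _ _ L_pos K B smooth, where F = F and R = "real m * c"])
    show "subalgebra M F" unfolding F_def by (rule subalgebra_nat_filt[OF X_meas])
    show "?S \<in> borel_measurable F"
    proof (rule borel_measurable_sum)
      fix a assume "a \<in> {..<m}"
      then have "a * k \<le> (m - 1) * k" "m \<noteq> 0" by (auto intro: mult_le_mono1)
      then show "X (i + a * k) \<in> borel_measurable F"
        unfolding F_def using i by (intro measurable_nat_filt) auto
    qed
    show "X (i + m * k) \<in> borel_measurable M" using X_meas i by simp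
    show "norm (?S \<omega>) \<le> real m * c" if "\<omega> \<in> space M" for \<omega>
      using sum_norm_bound[of "{..<m}" "\<lambda>a. X (i + a * k) \<omega>" c] X_bound that i by simp
    show "L * norm (X (i + m * k) \<omega>) \<le> 1" if "\<omega> \<in> space M" for \<omega>
    proof -
      have "L * norm (X (i + m * k) \<omega>) \<le> L * c"
        using X_bound that i L_pos by (intro mult_left_mono) auto
      then show ?thesis using Lc by linarith
    qed
    show "expectation (\<lambda>\<omega>. indicator A \<omega> * blinfun_apply s (X (i + m * k) \<omega>)) \<le> K * prob A"
      if A: "A \<in> sets F" and s: "norm s \<le> 1" for A and s :: "'b \<Rightarrow>\<^sub>L real"
    proof (cases "m = 0")
      case True
      have "integrable M (X i)" by (rule integrable_bounded[OF X_meas X_bound]) (use i in auto)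
      then have "expectation (\<lambda>\<omega>. blinfun_apply s (X i \<omega>)) = 0"
        using integral_bounded_linear[OF blinfun.bounded_linear_right[of s], of M "X i"] centered[OF i]
        by (simp add: blinfun.zero_right)
      moreover have "A = {} \<or> A = space M" using A True by (simp add: F_def sets_nat_filt_0)
      ultimately show ?thesis using K True by (auto simp: ind_cong prob_space)
    next
      case False
      have "expectation (\<lambda>\<omega>. indicator A \<omega> * blinfun_apply s (X (i + (m - 1) * k + k) \<omega>)) \<le> K * prob A"
        by (rule drift[OF _ _ s]) (use A i False in \<open>auto simp: F_def\<close>)
      then show ?thesis unfolding next_index[OF False] .
    qed
    show "expectation (\<lambda>\<omega>. indicator A \<omega> * (norm (X (i + m * k) \<omega>))\<^sup>2) \<le> W * prob A" if A: "A \<in> sets F" for A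
    proof (cases "m = 0")
      case True
      have "A = {} \<or> A = space M" using A True by (simp add: F_def sets_nat_filt_0)
      then show ?thesis using second_moment[OF i] True by (auto simp: ind_cong prob_space)
    next
      case False
      have "expectation (\<lambda>\<omega>. indicator A \<omega> * (norm (X (i + (m - 1) * k + k) \<omega>))\<^sup>2) \<le> W * prob A"
        by (rule var) (use A i False in \<open>auto simp: F_def\<close>)
      then show ?thesis unfolding next_index[OF False] .
    qed
  qed
  also have "\<dots> \<le> (1 + L * K + L\<^sup>2 * B * W) * (1 + L * K + L\<^sup>2 * B * W) ^ m"
    using Suc.IH L_pos K B W by (intro mult_left_mono) auto
  finally show ?case by simp
qed

end

section \<open>Recombining the classes and the tail bound\<close>

text \<open>Weighting each class by its share m i / n of the indices writes the bound on the overall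
  mean as a convex combination of scaled class sums, so Jensen applies without any independence
  between classes.\<close>

lemma cosh_norm_mean_le:
  fixes x :: "nat \<Rightarrow> 'a::real_normed_vector"
  assumes n: "n = l * k + r" and r: "r < k" and l: "1 \<le> l" and \<theta>: "0 \<le> \<theta>"
    and m: "\<And>i. m i = (if i \<le> r then Suc l else l)"
  shows "cosh (\<theta> * norm ((1 / real n) *\<^sub>R (\<Sum>i=1..n. x i)))
    \<le> (\<Sum>i=1..k. real (m i) / real n * cosh (\<theta> / real (m i) * norm (\<Sum>a<m i. x (i + a * k))))"
    and "(\<Sum>i=1..k. real (m i) / real n) = 1"
proof -
  have n_pos: "0 < n" using n r l by auto
  have m_pos: "0 < m i" for i using l m by auto
  have blocks: "(\<Sum>i=1..n. x i) = (\<Sum>i=1..k. \<Sum>a<m i. x (i + a * k))"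
    unfolding n m by (rule sum_residue_blocks) (use r in simp)
  have "(\<Sum>i=1..n. 1) = (\<Sum>i=1..k. \<Sum>a<m i. 1 :: real)"
    unfolding n m by (rule sum_residue_blocks) (use r in simp)
  then have "real n = (\<Sum>i=1..k. real (m i))" by simp
  then show total: "(\<Sum>i=1..k. real (m i) / real n) = 1"
    using n_pos by (simp flip: sum_divide_distrib)
  let ?b = "\<lambda>i. \<theta> / real (m i) * norm (\<Sum>a<m i. x (i + a * k))"
  have "\<theta> * norm ((1 / real n) *\<^sub>R (\<Sum>i=1..n. x i)) = \<theta> / real n * norm (\<Sum>i=1..k. \<Sum>a<m i. x (i + a * k))"
    unfolding blocks by simp
  also have "\<dots> \<le> \<theta> / real n * (\<Sum>i=1..k. norm (\<Sum>a<m i. x (i + a * k)))"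
    using \<theta> by (intro mult_left_mono norm_sum) auto
  also have "\<dots> = (\<Sum>i=1..k. real (m i) / real n * ?b i)"
    unfolding sum_distrib_left using m_pos by (intro sum.cong) (auto simp: field_simps)
  finally have "\<theta> * norm ((1 / real n) *\<^sub>R (\<Sum>i=1..n. x i)) \<le> (\<Sum>i=1..k. real (m i) / real n * ?b i)" .
  then have "cosh (\<theta> * norm ((1 / real n) *\<^sub>R (\<Sum>i=1..n. x i))) \<le> cosh (\<Sum>i=1..k. real (m i) / real n * ?b i)"
    using \<theta> by (subst cosh_real_nonneg_le_iff) (auto intro!: sum_nonneg)
  also have "\<dots> \<le> (\<Sum>i=1..k. real (m i) / real n * cosh (?b i))"
    using convex_on_sum[OF _ _ convex_on_cosh total, where y = ?b] r by simp
  finally show "cosh (\<theta> * norm ((1 / real n) *\<^sub>R (\<Sum>i=1..n. x i)))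
    \<le> (\<Sum>i=1..k. real (m i) / real n * cosh (?b i))" .
qed

theorem theorem3p1:
  fixes M :: "'w measure"
    and X :: "nat \<Rightarrow> 'w \<Rightarrow> 'b::{banach, second_countable_topology}"
    and C :: "('b \<Rightarrow> real) set" and Cn :: "('b \<Rightarrow> real) \<Rightarrow> real"
    and c sigma2 A1 A2 C1 C2 \<nu> :: real
    and n l k r :: nat
  assumes prob: "prob_space M"
    and meas: "\<And>i. 1 \<le> i \<Longrightarrow> X i \<in> borel_measurable M"
    and c_pos: "0 < c"
    and vals: "\<And>i \<omega>. 1 \<le> i \<Longrightarrow> \<omega> \<in> space M \<Longrightarrow> norm (X i \<omega>) \<le> c"
    and centered: "\<And>i. 1 \<le> i \<Longrightarrow> integral\<^sup>L M (X i) = 0"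
    and Cspace: "C_space c C Cn"
    and Cmeas: "\<And>\<phi>. \<phi> \<in> C \<Longrightarrow> \<phi> \<in> borel_measurable borel"
    \<comment> \<open>Assumption A1\<close>
    and A1_ge: "1 \<le> A1" and A2_pos: "0 < A2"
    and norm_twice: "\<And>x v :: 'b. x \<noteq> 0 \<Longrightarrow> twice_gateaux_differentiable norm x v"
    and norm_d1: "\<And>x v :: 'b. x \<noteq> 0 \<Longrightarrow> \<bar>gateaux_deriv norm x v\<bar> \<le> A1 * norm v"
    and norm_d2: "\<And>x v :: 'b. x \<noteq> 0 \<Longrightarrow> \<bar>gateaux_deriv2 norm x v\<bar> \<le> A2 * (norm v)\<^sup>2 / norm x"
    \<comment> \<open>Assumption A2\<close>
    and sigma2_pos: "0 < sigma2"
    and second_moment: "\<And>i. 1 \<le> i \<Longrightarrow> integral\<^sup>L M (\<lambda>\<omega>. (norm (X i \<omega>))\<^sup>2) \<le> sigma2"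
    \<comment> \<open>Assumption A3\<close>
    and h1_in: "\<And>s :: 'b \<Rightarrow>\<^sub>L real. onX c (blinfun_apply s) \<in> C"
    and h2_in: "onX c (\<lambda>x. (norm x)\<^sup>2) \<in> C"
    and C1_pos: "0 < C1" and C2_nonneg: "0 \<le> C2"
    and h1_bound: "\<And>s :: 'b \<Rightarrow>\<^sub>L real. norm s \<le> 1 \<Longrightarrow> Cn (onX c (blinfun_apply s)) \<le> C1"
    and h2_bound: "Cn (onX c (\<lambda>x. (norm x)\<^sup>2)) \<le> C2"
    \<comment> \<open>block decomposition\<close>
    and n_pos: "1 \<le> n" and l_ge: "2 \<le> l" and k_pos: "1 \<le> k"
    and decomp: "n = l * k + r" and r_lt: "r < k"
    and nu_pos: "0 < \<nu>"
    and Phi_fin: "mixing_coeff M X C Cn k \<noteq> \<infinity>"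
  shows "measure M {\<omega> \<in> space M.
            norm ((1 / real n) *\<^sub>R (\<Sum>i=1..n. X i \<omega>)) \<ge>
              4 * A1 * C1 * real_of_ereal (mixing_coeff M X C Cn k)
              + 4 * sqrt ((A1\<^sup>2 + A2) * (sigma2 + C2 * real_of_ereal (mixing_coeff M X C Cn k)) * \<nu> / real l)
              + 4 * c * \<nu> / (3 * real l)}
         \<le> 2 * exp (- \<nu>)"
proof -
  interpret prob_space M by (rule prob)
  interpret C_mixing_process M X C Cn c k
    by unfold_locales (use meas vals Cspace Cmeas Phi_fin in auto)
  define B where "B = A1\<^sup>2 + A2"
  define K where "K = C1 * \<Phi>"
  define W where "W = sigma2 + C2 * \<Phi>"
  define t where "t = 4 * A1 * C1 * \<Phi> + 4 * sqrt (B * W * \<nu> / real l) + 4 * c * \<nu> / (3 * real l)"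
  define Y where "Y = (\<lambda>\<omega>. norm ((1 / real n) *\<^sub>R (\<Sum>i=1..n. X i \<omega>)))"
  define m where "m = (\<lambda>i. if i \<le> r then Suc l else l)"
  have B: "0 < B" using A2_pos by (simp add: B_def add_nonneg_pos)
  have K: "0 \<le> K" using C1_pos Phi_nonneg by (simp add: K_def)
  have W: "0 < W" using sigma2_pos C2_nonneg Phi_nonneg by (simp add: W_def add_pos_nonneg)
  have l_pos: "0 < real l" using l_ge by simp
  have m_ge: "l \<le> m i" "0 < m i" for i using l_ge by (auto simp: m_def)
  have onX_X: "onX c f (X i \<omega>) = f (X i \<omega>)" if "\<omega> \<in> space M" "1 \<le> i" for f :: "'b \<Rightarrow> real" and i \<omega>
    using vals that by (simp add: onX_def)
  \<comment> \<open>The process stays in the ball, so truncation changes nothing. The free factor h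
    covers the indicator of A and the constant 1, which is why 1 is written out as a factor
    below.\<close>
  have onX_exp: "expectation (\<lambda>\<omega>. h \<omega> * onX c f (X i \<omega>)) = expectation (\<lambda>\<omega>. h \<omega> * f (X i \<omega>))"
    if "1 \<le> i" for f :: "'b \<Rightarrow> real" and h i
    by (rule Bochner_Integration.integral_cong) (use onX_X that in auto)
  have drift: "expectation (\<lambda>\<omega>. indicator A \<omega> * blinfun_apply s (X (i + k) \<omega>)) \<le> K * prob A"
    if i: "1 \<le> i" and A: "A \<in> sets (nat_filt M X i)" and s: "norm s \<le> 1" for i A and s :: "'b \<Rightarrow>\<^sub>L real"
  proof -
    have "integrable M (X (i + k))"
      by (rule integrable_bounded[where K = c]) (use meas vals i in auto)
    then have "expectation (\<lambda>\<omega>. blinfun_apply s (X (i + k) \<omega>)) = 0"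
      using integral_bounded_linear[OF blinfun.bounded_linear_right[of s], of M "X (i + k)"] centered[of "i + k"] i
      by (simp add: blinfun.zero_right)
    moreover have "expectation (\<lambda>\<omega>. indicator A \<omega> * onX c (blinfun_apply s) (X (i + k) \<omega>))
        \<le> (expectation (\<lambda>\<omega>. 1 * onX c (blinfun_apply s) (X (i + k) \<omega>)) + C1 * \<Phi>) * prob A"
      using mixing_le[OF h1_in h1_bound[OF s] _ i A] C1_pos by simp
    ultimately show ?thesis using i by (subst (asm) (1 2) onX_exp) (auto simp: K_def)
  qed
  have var: "expectation (\<lambda>\<omega>. indicator A \<omega> * (norm (X (i + k) \<omega>))\<^sup>2) \<le> W * prob A"
    if i: "1 \<le> i" and A: "A \<in> sets (nat_filt M X i)" for i A
  proof -
    have "expectation (\<lambda>\<omega>. indicator A \<omega> * onX c (\<lambda>x. (norm x)\<^sup>2) (X (i + k) \<omega>))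
        \<le> (expectation (\<lambda>\<omega>. 1 * onX c (\<lambda>x. (norm x)\<^sup>2) (X (i + k) \<omega>)) + C2 * \<Phi>) * prob A"
      using mixing_le[OF h2_in h2_bound C2_nonneg i A] by simp
    then have "expectation (\<lambda>\<omega>. indicator A \<omega> * (norm (X (i + k) \<omega>))\<^sup>2)
        \<le> (expectation (\<lambda>\<omega>. (norm (X (i + k) \<omega>))\<^sup>2) + C2 * \<Phi>) * prob A"
      using i by (subst (asm) (1 2) onX_exp) auto
    also have "\<dots> \<le> W * prob A"
      using second_moment[of "i + k"] i by (intro mult_right_mono) (auto simp: W_def)
    finally show ?thesis .
  qed
  have second_moment': "expectation (\<lambda>\<omega>. (norm (X i \<omega>))\<^sup>2) \<le> W" if "1 \<le> i" for i
    using second_moment[OF that] C2_nonneg Phi_nonneg by (simp add: W_def add_increasing2)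
  \<comment> \<open>The functionals s have norm at most 1, so the drift constant is C1 * \<Phi>; it
    fits under the first term of the threshold because A1 is at least 1.\<close>
  have "1 * K \<le> A1 * K" using A1_ge K by (intro mult_right_mono) auto
  then have "K \<le> 4 * A1 * C1 * \<Phi>" using K by (simp add: K_def)
  then have "K + 4 * sqrt (B * W * \<nu> / real l) + 4 * c * \<nu> / (3 * real l) \<le> t"
    by (simp add: t_def)
  then obtain \<theta> where \<theta>: "0 < \<theta>" "\<theta> * c \<le> real l" "\<theta> * K + \<theta>\<^sup>2 * (B * W) / real l - \<theta> * t \<le> - \<nu>"
    by (rule Bernstein_exponent[OF K mult_pos_pos[OF B W] nu_pos c_pos l_pos])
  let ?b = "\<lambda>i \<omega>. cosh (\<theta> / real (m i) * norm (\<Sum>a<m i. X (i + a * k) \<omega>))"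
  have block: "expectation (?b i) \<le> exp (\<theta> * K + \<theta>\<^sup>2 * (B * W) / real l)" if i: "1 \<le> i" for i
  proof -
    let ?L = "\<theta> / real (m i)"
    have L_pos: "0 < ?L" using \<theta>(1) m_ge by simp
    have "\<theta> * c \<le> real (m i)" using \<theta>(2) m_ge(1)[of i] by linarith
    then have Lc: "?L * c \<le> 1" using m_ge(2)[of i] by (simp add: field_simps)
    have "expectation (?b i) \<le> (1 + ?L * K + ?L\<^sup>2 * B * W) ^ m i"
    proof (rule block_exponential_moment[OF L_pos Lc K _ _ _ _ second_moment' drift var i])
      show "\<exists>s::'b \<Rightarrow>\<^sub>L real. norm s \<le> 1 \<and> (\<forall>z. ?L * norm z \<le> 1 \<longrightarrow> cosh (?L * norm (x + z))
          \<le> cosh (?L * norm x) * (1 + B * (?L * norm z)\<^sup>2) + ?L * sinh (?L * norm x) * blinfun_apply s z)" for x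
        using cosh_norm_add_le[OF A1_ge A2_pos L_pos norm_twice norm_d1 norm_d2, of x] unfolding B_def by metis
    qed (use B W centered in auto)
    also have "\<dots> \<le> exp (?L * K + ?L\<^sup>2 * B * W) ^ m i"
    proof (rule power_mono)
      show "1 + ?L * K + ?L\<^sup>2 * B * W \<le> exp (?L * K + ?L\<^sup>2 * B * W)"
        using exp_ge_add_one_self[of "?L * K + ?L\<^sup>2 * B * W"] by (simp only: add.assoc)
      show "0 \<le> 1 + ?L * K + ?L\<^sup>2 * B * W"
        by (intro add_nonneg_nonneg mult_nonneg_nonneg zero_le_one zero_le_power2 K less_imp_le[OF L_pos]
          less_imp_le[OF B] less_imp_le[OF W])
    qed
    also have "\<dots> = exp (real (m i) * (?L * K + ?L\<^sup>2 * B * W))"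
      by (simp add: exp_of_nat_mult)
    \<comment> \<open>The length of the class cancels in the drift and divides the variance term, so
      the longer classes also obey the bound for length l.\<close>
    also have "real (m i) * (?L * K + ?L\<^sup>2 * B * W) = \<theta> * K + \<theta>\<^sup>2 * (B * W) / real (m i)"
      using m_ge(2)[of i] by (simp add: field_simps power2_eq_square)
    also have "exp \<dots> \<le> exp (\<theta> * K + \<theta>\<^sup>2 * (B * W) / real l)"
      using m_ge[of i] l_ge B W by (auto intro!: divide_left_mono)
    finally show ?thesis .
  qed
  have mean: "cosh (\<theta> * Y \<omega>) \<le> (\<Sum>i=1..k. real (m i) / real n * ?b i \<omega>)" for \<omega>
    unfolding Y_def by (rule cosh_norm_mean_le(1)[OF decomp r_lt]) (use l_ge \<theta>(1) in \<open>auto simp: m_def\<close>)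
  have weights: "(\<Sum>i=1..k. real (m i) / real n) = 1"
    by (rule cosh_norm_mean_le(2)[OF decomp r_lt _ order_refl]) (use l_ge in \<open>auto simp: m_def\<close>)
  have b_int: "integrable M (?b i)" if "i \<in> {1..k}" for i
  proof (rule integrable_bounded[where K = "cosh (\<theta> * c)"])
    have [measurable]: "X (i + a * k) \<in> borel_measurable M" for a
      using meas that by simp
    show "?b i \<in> borel_measurable M" by measurable
    fix \<omega> assume "\<omega> \<in> space M"
    then have "norm (\<Sum>a<m i. X (i + a * k) \<omega>) \<le> real (m i) * c"
      using sum_norm_bound[of "{..<m i}" "\<lambda>a. X (i + a * k) \<omega>" c] vals that by simp
    then have "\<theta> / real (m i) * norm (\<Sum>a<m i. X (i + a * k) \<omega>) \<le> \<theta> / real (m i) * (real (m i) * c)"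
      using \<theta>(1) by (intro mult_left_mono) auto
    then have "\<theta> / real (m i) * norm (\<Sum>a<m i. X (i + a * k) \<omega>) \<le> \<theta> * c"
      using m_ge(2)[of i] by simp
    then show "norm (?b i \<omega>) \<le> cosh (\<theta> * c)"
      using \<theta>(1) c_pos by (simp add: cosh_real_nonneg_le_iff)
  qed
  have sum_int: "integrable M (\<lambda>\<omega>. \<Sum>i=1..k. real (m i) / real n * ?b i \<omega>)"
    using b_int by (intro Bochner_Integration.integrable_sum integrable_mult_right) auto
  have [measurable]: "(\<lambda>\<omega>. \<Sum>i=1..n. X i \<omega>) \<in> borel_measurable M"
    by (rule borel_measurable_sum) (use meas in auto)
  have [measurable]: "Y \<in> borel_measurable M"
    unfolding Y_def by measurable
  have Y_int: "integrable M (\<lambda>\<omega>. cosh (\<theta> * Y \<omega>))"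
  proof (rule Bochner_Integration.integrable_bound[OF sum_int])
    show "AE \<omega> in M. norm (cosh (\<theta> * Y \<omega>)) \<le> norm (\<Sum>i=1..k. real (m i) / real n * ?b i \<omega>)"
      using order_trans[OF mean abs_ge_self] by simp
  qed measurable
  have "expectation (\<lambda>\<omega>. cosh (\<theta> * Y \<omega>)) \<le> expectation (\<lambda>\<omega>. \<Sum>i=1..k. real (m i) / real n * ?b i \<omega>)"
    by (rule integral_mono[OF Y_int sum_int mean])
  also have "\<dots> = (\<Sum>i=1..k. real (m i) / real n * expectation (?b i))"
    using b_int by (subst Bochner_Integration.integral_sum) auto
  also have "\<dots> \<le> (\<Sum>i=1..k. real (m i) / real n * exp (\<theta> * K + \<theta>\<^sup>2 * (B * W) / real l))"
    using block by (intro sum_mono mult_left_mono) auto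
  also have "\<dots> = exp (\<theta> * K + \<theta>\<^sup>2 * (B * W) / real l)"
    unfolding sum_distrib_right[symmetric] weights by simp
  finally have moment: "expectation (\<lambda>\<omega>. cosh (\<theta> * Y \<omega>)) \<le> exp (\<theta> * K + \<theta>\<^sup>2 * (B * W) / real l)" .
  have "prob {\<omega> \<in> space M. t \<le> Y \<omega>} \<le> prob {\<omega> \<in> space M. exp (\<theta> * t) / 2 \<le> cosh (\<theta> * Y \<omega>)}"
  proof (rule finite_measure_mono)
    \<comment> \<open>Markov is applied to cosh rather than exp; the lost half is the factor 2 of
      the conclusion.\<close>
    have "exp (\<theta> * t) / 2 \<le> cosh (\<theta> * y)" if "t \<le> y" for y
    proof -
      have "exp (\<theta> * t) \<le> exp (\<theta> * y)" using that \<theta>(1) by simp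
      then show ?thesis by (simp add: cosh_field_def add_increasing2)
    qed
    then show "{\<omega> \<in> space M. t \<le> Y \<omega>} \<subseteq> {\<omega> \<in> space M. exp (\<theta> * t) / 2 \<le> cosh (\<theta> * Y \<omega>)}"
      by auto
  qed measurable
  also have "\<dots> \<le> expectation (\<lambda>\<omega>. cosh (\<theta> * Y \<omega>)) / (exp (\<theta> * t) / 2)"
    by (rule integral_Markov_inequality_measure[OF Y_int sets.empty_sets]) auto
  also have "\<dots> \<le> exp (\<theta> * K + \<theta>\<^sup>2 * (B * W) / real l) / (exp (\<theta> * t) / 2)"
    using moment by (intro divide_right_mono) auto
  also have "\<dots> = 2 * exp (\<theta> * K + \<theta>\<^sup>2 * (B * W) / real l - \<theta> * t)"
    by (simp add: exp_diff)
  also have "\<dots> \<le> 2 * exp (- \<nu>)" using \<theta>(3) by simp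
  finally show ?thesis
    unfolding t_def Y_def B_def W_def \<Phi>_def .
qed

end
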